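(* Let $E$ be a Banach space over $\mathbb{K}$ and $P\in\mathcal{P}(^{3}E)$. Then $S_{p;q}(P)$ is either empty or a linear subspace of $E$ for every $1\le q\le p<\infty$.
   Context: $\mathbb{K}=\mathbb{R}$ or $\mathbb{C}$. $\mathcal{P}(^{n}E)$ is the space of continuous scalar-valued $n$-homogeneous polynomials on $E$. $\ell_p(F)$ is the space of sequences $(y_j)_{j=1}^\infty$ in a Banach space $F$ with $\sum_j\|y_j\|^p<\infty$. $\ell_q^{w}(E)$ is the space of sequences $(x_j)_{j=1}^\infty$ in $E$ with $(\varphi(x_j))_j\in\ell_q$ for all $\varphi\in E'$ (the dual of $E$), normed by $\|(x_j)_j\|_{w,q}=\sup\{(\sum_j|\varphi(x_j)|^q)^{1/q}:\varphi\in E',\|\varphi\|\le1\}$. $\ell_q^{u}(E)$ (unconditionally $q$-summable sequences) is the subspace of those $(x_j)_j\in\ell_q^w(E)$ with $\lim_{k\to\infty}\|(x_j)_{j=k}^\infty\|_{w,q}=0$. For $1\le q\le p<\infty$, a mapping $f\colon E\to F$ between Banach spaces is $(p;q)$-summing at $a\in E$ if $(f(a+x_j)-f(a))_{j=1}^\infty\in\ell_p(F)$ whenever $(x_j)_{j=1}^\infty\in\ell_q^u(E)$. The $(p;q)$-summing set of $f$ is $S_{p;q}(f)=\{a\in E: f\text{ is }(p;q)\text{-summing at }a\}$. *)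

theory Defs
  imports "HOL-Analysis.Analysis"
begin

text \<open>
  The scalar field is a type of class \<^class>\<open>real_normed_field\<close>. By the Gelfand-Mazur theorem such a
  field is isometrically isomorphic to the reals or to the complex numbers, so the class
  expresses exactly the convention that the scalar field is one of these two.

  A Banach space over it is a type of class \<^class>\<open>banach\<close> (which supplies the norm, its
  completeness and the underlying real structure) together with a scalar multiplication
  \<open>smul\<close> that extends the real one.
\<close>

locale banach_space_over = vector_space smul
  for smul :: "'k::real_normed_field \<Rightarrow> 'e::banach \<Rightarrow> 'e" +
  assumes norm_smul: "norm (smul c x) = norm c * norm x"
    and smul_of_real: "smul (of_real r) x = r *\<^sub>R x"

lemma banach_space_over_real: "banach_space_over ((*\<^sub>R) :: real \<Rightarrow> 'e::banach \<Rightarrow> 'e)"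
  by unfold_locales (simp_all add: scaleR_add_right scaleR_add_left)

lemma banach_space_over_complex: "banach_space_over ((*) :: complex \<Rightarrow> complex \<Rightarrow> complex)"
  by unfold_locales (simp_all add: algebra_simps norm_mult scaleR_conv_of_real)

text \<open>The space of \<open>n\<close>-tuples is represented by the extensional functions on \<open>{..<n}\<close>.\<close>

definition multilinear_form ::
    "('k::real_normed_field \<Rightarrow> 'e::banach \<Rightarrow> 'e) \<Rightarrow> nat \<Rightarrow> ((nat \<Rightarrow> 'e) \<Rightarrow> 'k) \<Rightarrow> bool" where
  "multilinear_form smul n A \<longleftrightarrow>
     (\<forall>x \<in> {..<n} \<rightarrow>\<^sub>E UNIV. \<forall>i<n. Vector_Spaces.linear smul (*) (\<lambda>y. A (x(i := y))))"

definition homogeneous_polynomials ::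
    "('k::real_normed_field \<Rightarrow> 'e::banach \<Rightarrow> 'e) \<Rightarrow> nat \<Rightarrow> ('e \<Rightarrow> 'k) set" where
  "homogeneous_polynomials smul n =
     {P. continuous_on UNIV P \<and>
         (\<exists>A. multilinear_form smul n A \<and> (\<forall>x. P x = A (\<lambda>i\<in>{..<n}. x)))}"

definition dual_space :: "('k::real_normed_field \<Rightarrow> 'e::banach \<Rightarrow> 'e) \<Rightarrow> ('e \<Rightarrow> 'k) set" where
  "dual_space smul = {\<phi>. Vector_Spaces.linear smul (*) \<phi> \<and> bounded_linear \<phi>}"

definition lp_seqs :: "real \<Rightarrow> (nat \<Rightarrow> 'f::real_normed_vector) set" where
  "lp_seqs p = {y. summable (\<lambda>j. norm (y j) powr p)}"

definition weak_lp_seqs ::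
    "('k::real_normed_field \<Rightarrow> 'e::banach \<Rightarrow> 'e) \<Rightarrow> real \<Rightarrow> (nat \<Rightarrow> 'e) set" where
  "weak_lp_seqs smul q = {x. \<forall>\<phi> \<in> dual_space smul. (\<lambda>j. \<phi> (x j)) \<in> lp_seqs q}"

text \<open>
  Only meaningful on \<^const>\<open>weak_lp_seqs\<close>, where all the series converge. The supremum is taken in
  \<^typ>\<open>ennreal\<close>, so that it does not presuppose boundedness.
\<close>

definition weak_norm ::
    "('k::real_normed_field \<Rightarrow> 'e::banach \<Rightarrow> 'e) \<Rightarrow> real \<Rightarrow> (nat \<Rightarrow> 'e) \<Rightarrow> ennreal" where
  "weak_norm smul q x =
     (SUP \<phi> \<in> {\<phi> \<in> dual_space smul. onorm \<phi> \<le> 1}.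
        ennreal ((\<Sum>j. norm (\<phi> (x j)) powr q) powr (1 / q)))"

definition uncond_lp_seqs ::
    "('k::real_normed_field \<Rightarrow> 'e::banach \<Rightarrow> 'e) \<Rightarrow> real \<Rightarrow> (nat \<Rightarrow> 'e) set" where
  "uncond_lp_seqs smul q =
     {x \<in> weak_lp_seqs smul q. (\<lambda>k. weak_norm smul q (\<lambda>j. x (k + j))) \<longlonglongrightarrow> 0}"

definition summing_at ::
    "('k::real_normed_field \<Rightarrow> 'e::banach \<Rightarrow> 'e) \<Rightarrow> real \<Rightarrow> real
      \<Rightarrow> ('e \<Rightarrow> 'f::real_normed_vector) \<Rightarrow> 'e \<Rightarrow> bool" where
  "summing_at smul p q f a \<longleftrightarrow>
     (\<forall>x \<in> uncond_lp_seqs smul q. (\<lambda>j. f (a + x j) - f a) \<in> lp_seqs p)"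

definition summing_set ::
    "('k::real_normed_field \<Rightarrow> 'e::banach \<Rightarrow> 'e) \<Rightarrow> real \<Rightarrow> real
      \<Rightarrow> ('e \<Rightarrow> 'f::real_normed_vector) \<Rightarrow> 'e set" where
  "summing_set smul p q f = {a. summing_at smul p q f a}"

end

theory Submission
  imports Defs
begin

text \<open>
  Let \<open>P\<close> be the diagonal of a trilinear form. Then
  \<open>P (a + x) - P a = L a x + B a x + P x\<close>, where \<open>L\<close> is quadratic in \<open>a\<close> and linear in \<open>x\<close>,
  and \<open>B\<close> is linear in \<open>a\<close> and quadratic in \<open>x\<close>
  (lemma \<open>cubic_expansion\<close>). The functional \<open>L a\<close> is continuous, so it maps every weakly
  \<open>q\<close>-summable sequence into \<open>\<ell>\<^sub>q \<subseteq> \<ell>\<^sub>p\<close> and has no influence on whether \<open>P\<close> is summing at \<open>a\<close>.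

  The two remaining terms have opposite parity in \<open>x\<close>, and the unconditionally summable sequences
  are stable under \<open>x \<mapsto> - x\<close>. Comparing \<open>x\<close> with \<open>- x\<close> therefore separates them: \<open>P\<close> is summing at
  \<open>a\<close> if and only if both \<open>P (x j)\<close> and \<open>B a (x j)\<close> are in \<open>\<ell>\<^sub>p\<close> for all such \<open>x\<close>
  (lemma \<open>summing_at_cubic_iff\<close>). The first condition does not involve \<open>a\<close>, and the second is linear
  in \<open>a\<close>; so as soon as the first one holds, the summing set is a subspace, and otherwise it is empty.
\<close>

lemma lp_seqs_mult:
  fixes y :: "nat \<Rightarrow> 'k::real_normed_field"
  assumes "y \<in> lp_seqs p"
  shows "(\<lambda>j. c * y j) \<in> lp_seqs p"
  using assms by (auto simp: lp_seqs_def norm_mult powr_mult intro: summable_mult)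

lemma lp_seqs_add:
  assumes p: "0 \<le> p" and y: "y \<in> lp_seqs p" and z: "z \<in> lp_seqs p"
  shows "(\<lambda>j. y j + z j) \<in> lp_seqs p"
proof -
  let ?g = "\<lambda>j. 2 powr p * (norm (y j) powr p + norm (z j) powr p)"
  have "summable ?g"
    using y z by (auto simp: lp_seqs_def intro!: summable_mult summable_add)
  moreover have "norm (norm (y j + z j) powr p) \<le> ?g j" for j
  proof -
    have "norm (y j + z j) \<le> 2 * max (norm (y j)) (norm (z j))"
      using norm_triangle_ineq[of "y j" "z j"] by linarith
    then have "norm (y j + z j) powr p \<le> (2 * max (norm (y j)) (norm (z j))) powr p"
      by (intro powr_mono2 p) auto
    also have "\<dots> = 2 powr p * max (norm (y j)) (norm (z j)) powr p"
      by (simp add: powr_mult le_max_iff_disj)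
    also have "\<dots> \<le> ?g j"
      by (intro mult_left_mono) (auto simp: max_def)
    finally show ?thesis by simp
  qed
  ultimately show ?thesis
    unfolding lp_seqs_def mem_Collect_eq by (rule summable_comparison_test'[where N = 0])
qed

text \<open>The terms of a sequence in \<open>\<ell>\<^sub>q\<close> are eventually at most 1, and there a larger exponent gives
  a smaller power.\<close>

lemma lp_seqs_mono:
  assumes "0 < q" "q \<le> p" and y: "y \<in> lp_seqs q"
  shows "y \<in> lp_seqs p"
proof -
  have s: "summable (\<lambda>j. norm (y j) powr q)"
    using y by (simp add: lp_seqs_def)
  have "\<forall>\<^sub>F j in sequentially. norm (y j) powr q < 1"
    using order_tendstoD(2)[OF summable_LIMSEQ_zero[OF s]] by simp
  then have "\<forall>\<^sub>F j in sequentially. norm (norm (y j) powr p) \<le> norm (y j) powr q"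
  proof eventually_elim
    case (elim j)
    have "norm (y j) \<le> 1"
    proof (rule ccontr)
      assume "\<not> norm (y j) \<le> 1"
      then have "1 \<le> norm (y j) powr q" using \<open>0 < q\<close> by (intro ge_one_powr_ge_zero) auto
      then show False using elim by simp
    qed
    then show ?case using \<open>q \<le> p\<close> by (simp add: powr_mono')
  qed
  then show ?thesis
    unfolding lp_seqs_def using s by (auto intro: summable_comparison_test_ev)
qed

context banach_space_over
begin

lemma uncond_lp_seqs_minus:
  assumes "x \<in> uncond_lp_seqs smul q"
  shows "(\<lambda>j. - x j) \<in> uncond_lp_seqs smul q"
proof -
  have m: "norm (\<phi> (- v)) = norm (\<phi> v)" if "\<phi> \<in> dual_space smul" for \<phi> v
    using that by (simp add: dual_space_def bounded_linear.linear linear_neg)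
  have "weak_norm smul q (\<lambda>j. - y j) = weak_norm smul q y" for y
    unfolding weak_norm_def by (intro SUP_cong) (auto simp: m)
  then show ?thesis
    using assms by (auto simp: uncond_lp_seqs_def weak_lp_seqs_def lp_seqs_def m)
qed

lemma continuous_linear_in_dual_space:
  assumes lin: "Vector_Spaces.linear smul (*) \<phi>" and cont: "isCont \<phi> 0"
  shows "\<phi> \<in> dual_space smul"
proof -
  interpret \<phi>: Vector_Spaces.linear smul "(*)" \<phi> by (fact lin)
  have scaleR: "\<phi> (r *\<^sub>R x) = r *\<^sub>R \<phi> x" for r x
    by (metis \<phi>.scale smul_of_real scaleR_conv_of_real)
  have real_linear: "linear \<phi>"
    by (intro linearI \<phi>.add scaleR)
  obtain d where "0 < d" and d: "\<And>x. norm x < d \<Longrightarrow> norm (\<phi> x) < 1"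
    using cont \<phi>.zero unfolding continuous_at_eps_delta dist_norm
    by (metis diff_zero zero_less_one)
  have "norm (\<phi> x) \<le> norm x * (2 / d)" for x
  proof (cases "x = 0")
    case False
    \<comment> \<open>rescale \<open>x\<close> to norm \<open>d / 2\<close>\<close>
    let ?r = "d / (2 * norm x)"
    have "norm (?r *\<^sub>R x) < d"
      using False \<open>0 < d\<close> by simp
    from d[OF this] have "?r * norm (\<phi> x) < 1"
      using \<open>0 < d\<close> by (simp add: scaleR)
    then show ?thesis using False \<open>0 < d\<close> by (simp add: field_simps)
  qed (simp add: \<phi>.zero)
  then have "bounded_linear \<phi>"
    using real_linear by (intro bounded_linear_intro[of \<phi> "2 / d"]) (auto simp: \<phi>.add scaleR)
  with lin show ?thesis by (simp add: dual_space_def)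
qed

lemma homogeneous_polynomial_3_trilinear:
  assumes "P \<in> homogeneous_polynomials smul 3"
  obtains T where
    "\<And>v w. Vector_Spaces.linear smul (*) (\<lambda>u. T u v w)"
    "\<And>u w. Vector_Spaces.linear smul (*) (\<lambda>v. T u v w)"
    "\<And>u v. Vector_Spaces.linear smul (*) (\<lambda>w. T u v w)"
    "\<And>x. P x = T x x x"
proof -
  obtain A where A: "multilinear_form smul 3 A" and P: "\<And>x. P x = A (\<lambda>i\<in>{..<3}. x)"
    using assms by (auto simp: homogeneous_polynomials_def)
  define t :: "'e \<Rightarrow> 'e \<Rightarrow> 'e \<Rightarrow> nat \<Rightarrow> 'e"
    where "t u v w = (\<lambda>i\<in>{..<3}. if i = 0 then u else if i = 1 then v else w)" for u v w
  have t: "t u v w \<in> {..<3} \<rightarrow>\<^sub>E UNIV" for u v w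
    by (auto simp: t_def)
  have upd: "(t u v w)(0 := y) = t y v w" "(t u v w)(1 := y) = t u y w"
    "(t u v w)(2 := y) = t u v y" for u v w y
    by (auto simp: t_def fun_eq_iff restrict_def)
  have lin: "Vector_Spaces.linear smul (*) (\<lambda>y. A ((t u v w)(i := y)))" if "i < 3" for u v w i
    using A t that by (auto simp: multilinear_form_def)
  show thesis
  proof (rule that[of "\<lambda>u v w. A (t u v w)"])
    show "Vector_Spaces.linear smul (*) (\<lambda>u. A (t u v w))" for v w
      using lin[of 0 0 v w] by (simp add: upd)
    show "Vector_Spaces.linear smul (*) (\<lambda>v. A (t u v w))" for u w
      using lin[of 1 u 0 w] by (simp only: upd)
    show "Vector_Spaces.linear smul (*) (\<lambda>w. A (t u v w))" for u v
      using lin[of 2 u v 0] by (simp add: upd)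
    show "P x = A (t x x x)" for x
      by (simp only: P t_def if_cancel)
  qed
qed

text \<open>
  With \<open>T\<close> the trilinear form, \<open>L a x\<close> collects the terms in which \<open>x\<close> fills one slot and \<open>B a x\<close>
  those in which it fills two. Only \<open>P\<close> is known to be continuous, not \<open>T\<close>; but the odd part of
  \<open>x \<mapsto> P (a + x)\<close> is \<open>L a x + P x\<close>, so \<open>L a\<close> is a combination of \<open>P x\<close>, \<open>P (a + x)\<close>
  and \<open>P (a - x)\<close> and inherits their continuity.
\<close>

lemma cubic_expansion:
  assumes hom: "P \<in> homogeneous_polynomials smul 3"
  obtains L B where
    "\<And>a x. P (a + x) - P a = L a x + B a x + P x"
    "\<And>a. L a \<in> dual_space smul"
    "\<And>x. Vector_Spaces.linear smul (*) (\<lambda>a. B a x)"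
    "\<And>a x. B a (- x) = B a x"
    "\<And>x. P (- x) = - P x"
proof -
  obtain T where
    lin: "\<And>v w. Vector_Spaces.linear smul (*) (\<lambda>u. T u v w)"
      "\<And>u w. Vector_Spaces.linear smul (*) (\<lambda>v. T u v w)"
      "\<And>u v. Vector_Spaces.linear smul (*) (\<lambda>w. T u v w)"
    and P: "\<And>x. P x = T x x x"
    using homogeneous_polynomial_3_trilinear[OF hom] by metis
  interpret T1: Vector_Spaces.linear smul "(*)" "\<lambda>u. T u v w" for v w by (fact lin)
  interpret T2: Vector_Spaces.linear smul "(*)" "\<lambda>v. T u v w" for u w by (fact lin)
  interpret T3: Vector_Spaces.linear smul "(*)" "\<lambda>w. T u v w" for u v by (fact lin)
  note add = T1.add T2.add T3.add
  note neg = T1.neg T2.neg T3.neg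
  define L where "L a x = T x a a + T a x a + T a a x" for a x
  define B where "B a x = T a x x + T x a x + T x x a" for a x
  have linL: "Vector_Spaces.linear smul (*) (L a)" for a
    by unfold_locales (simp_all add: L_def add T1.scale T2.scale T3.scale algebra_simps)
  have linB: "Vector_Spaces.linear smul (*) (\<lambda>a. B a x)" for x
    by unfold_locales (simp_all add: B_def add T1.scale T2.scale T3.scale algebra_simps)
  have expand: "P (a + x) - P a = L a x + B a x + P x" for a x
    by (simp add: P L_def B_def add)
  have odd_part: "L a = (\<lambda>x. (P (a + x) - P (a - x)) / 2 - P x)" for a
  proof
    fix x
    have "P (a + - x) - P a = - L a x + B a x - P x"
      unfolding expand by (simp add: P L_def B_def neg)
    then have "P (a + x) - P (a - x) = 2 * (L a x + P x)"
      using expand[of a x] by (simp add: algebra_simps)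
    then show "L a x = (P (a + x) - P (a - x)) / 2 - P x"
      by (simp del: distrib_left_numeral)
  qed
  have cont_P: "isCont P x" for x
    using hom by (simp add: homogeneous_polynomials_def continuous_on_eq_continuous_at)
  have cont_shift: "isCont (\<lambda>x. P (a + x)) 0" "isCont (\<lambda>x. P (a - x)) 0" for a
    by (rule isCont_o2[where g = P], intro continuous_intros, rule cont_P)+
  have "isCont (L a) 0" for a
    unfolding odd_part by (intro isCont_diff isCont_divide cont_shift cont_P) simp_all
  then have "L a \<in> dual_space smul" for a
    by (intro continuous_linear_in_dual_space linL)
  then show thesis
    using expand linB by (intro that[of L B]) (simp_all add: P B_def neg)
qed

text \<open>
  For sequences \<open>x\<close> and \<open>- x\<close> the increments of \<open>P\<close> at \<open>a\<close> are \<open>B a x + (L a x + P x)\<close> and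
  \<open>B a x - (L a x + P x)\<close>. Half their sum and half their difference isolate \<open>B a x\<close> and
  \<open>L a x + P x\<close>.
\<close>

lemma summing_at_cubic_iff:
  fixes P :: "'e \<Rightarrow> 'k"
  assumes expand: "\<And>a x. P (a + x) - P a = L a x + B a x + P x"
    and dual: "\<And>a. L a \<in> dual_space smul"
    and even_B: "\<And>a x. B a (- x) = B a x"
    and odd_P: "\<And>x. P (- x) = - P x"
    and "0 < q" "q \<le> p"
  shows "summing_at smul p q P a \<longleftrightarrow>
    (\<forall>x \<in> uncond_lp_seqs smul q.
       (\<lambda>j. P (x j)) \<in> lp_seqs p \<and> (\<lambda>j. B a (x j)) \<in> lp_seqs p)"
proof -
  have lp_add: "(\<lambda>j. y j + z j) \<in> lp_seqs p"
    if "y \<in> lp_seqs p" "z \<in> lp_seqs p" for y z :: "nat \<Rightarrow> 'k"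
    using that \<open>0 < q\<close> \<open>q \<le> p\<close> by (intro lp_seqs_add) auto
  have L: "(\<lambda>j. L a (x j)) \<in> lp_seqs p" if "x \<in> uncond_lp_seqs smul q" for x
    using that dual \<open>0 < q\<close> \<open>q \<le> p\<close>
    by (intro lp_seqs_mono[of q p]) (auto simp: uncond_lp_seqs_def weak_lp_seqs_def)
  have odd_L: "L a (- x) = - L a x" for x
    using dual[of a] by (simp add: dual_space_def bounded_linear.linear linear_neg)
  show ?thesis
    unfolding summing_at_def
  proof (intro iffI ballI conjI)
    fix x assume *: "\<forall>x\<in>uncond_lp_seqs smul q. (\<lambda>j. P (a + x j) - P a) \<in> lp_seqs p"
      and x: "x \<in> uncond_lp_seqs smul q"
    have plus: "(\<lambda>j. L a (x j) + B a (x j) + P (x j)) \<in> lp_seqs p"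
      using bspec[OF * x] by (simp only: expand)
    have minus: "(\<lambda>j. - L a (x j) + B a (x j) + - P (x j)) \<in> lp_seqs p"
      using bspec[OF * uncond_lp_seqs_minus[OF x]] by (simp only: expand odd_L even_B odd_P)
    show "(\<lambda>j. B a (x j)) \<in> lp_seqs p"
      using lp_seqs_mult[OF lp_add[OF plus minus], of "1 / 2"] by simp
    have "(\<lambda>j. L a (x j) + P (x j)) \<in> lp_seqs p"
    proof -
      have "1 / 2 * (l + b + c + - 1 * (- l + b + - c)) = l + c" for l b c :: 'k
        by simp
      then show ?thesis
        using lp_seqs_mult[OF lp_add[OF plus lp_seqs_mult[OF minus, of "- 1"]], of "1 / 2"]
        by (simp only:)
    qed
    from lp_add[OF this lp_seqs_mult[OF L[OF x], of "- 1"]]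
    show "(\<lambda>j. P (x j)) \<in> lp_seqs p" by simp
  next
    fix x assume *: "\<forall>x\<in>uncond_lp_seqs smul q.
        (\<lambda>j. P (x j)) \<in> lp_seqs p \<and> (\<lambda>j. B a (x j)) \<in> lp_seqs p"
      and x: "x \<in> uncond_lp_seqs smul q"
    then show "(\<lambda>j. P (a + x j) - P a) \<in> lp_seqs p"
      unfolding expand by (intro lp_add L) auto
  qed
qed

end

theorem proposition4p3:
  fixes smul :: "'k::real_normed_field \<Rightarrow> 'e::banach \<Rightarrow> 'e"
    and P :: "'e \<Rightarrow> 'k"
    and p q :: real
  assumes "banach_space_over smul"
    and "P \<in> homogeneous_polynomials smul 3"
    and "1 \<le> q" and "q \<le> p"
  shows "summing_set smul p q P = {} \<or> module.subspace smul (summing_set smul p q P)"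
proof -
  interpret banach_space_over smul by (fact assms(1))
  obtain L B where
    expansion: "\<And>a x. P (a + x) - P a = L a x + B a x + P x"
      "\<And>a. L a \<in> dual_space smul"
      "\<And>a x. B a (- x) = B a x"
      "\<And>x. P (- x) = - P x"
    and lin: "\<And>x. Vector_Spaces.linear smul (*) (\<lambda>a. B a x)"
    using cubic_expansion[OF assms(2)] by metis
  interpret B: Vector_Spaces.linear smul "(*)" "\<lambda>a. B a x" for x by (fact lin)
  let ?U = "uncond_lp_seqs smul q"
  have S: "a \<in> summing_set smul p q P \<longleftrightarrow>
      (\<forall>x\<in>?U. (\<lambda>j. P (x j)) \<in> lp_seqs p \<and> (\<lambda>j. B a (x j)) \<in> lp_seqs p)" for a
    using summing_at_cubic_iff[of P L B, OF expansion] assms(3,4) by (simp add: summing_set_def)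
  show ?thesis
  proof (cases "\<forall>x\<in>?U. (\<lambda>j. P (x j)) \<in> lp_seqs p")
    case True
    have "(\<lambda>j. 0 :: 'k) \<in> lp_seqs p"
      by (simp add: lp_seqs_def)
    then have "subspace (summing_set smul p q P)"
      using True assms(3,4)
      by (intro subspaceI) (auto simp: S B.zero B.add B.scale intro: lp_seqs_add lp_seqs_mult)
    then show ?thesis ..
  next
    case False
    then have "summing_set smul p q P = {}"
      by (auto simp: S)
    then show ?thesis ..
  qed
qed

end
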